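(* Identify $\mathcal{P}(\mathbb{N})$ with the Cantor space $\{0,1\}^{\mathbb{N}}$ (product topology). Then the family $\Sigma_\star$ of totally irreducible subsets of $\mathbb{N}$ is a comeager subset of $\mathcal{P}(\mathbb{N})$. In particular, the family $\Sigma$ of irreducible subsets of $\mathbb{N}$ is also comeager.
   Context: $\mathbb{N}$ denotes the set of nonnegative integers. For $B,C\subseteq\mathbb{N}$, $B+C:=\{b+c: b\in B, c\in C\}$. A set $A\subseteq\mathbb{N}$ is irreducible if there do not exist $B,C\subseteq\mathbb{N}$ with $|B|,|C|\ge 2$ and $A=B+C$. A set $A\subseteq\mathbb{N}$ is totally irreducible if there do not exist $B,C\subseteq\mathbb{N}$ with $|B|,|C|\ge 2$ such that the symmetric difference $A\bigtriangleup(B+C)$ is finite. A subset of a topological space is comeager if its complement is contained in a countable union of closed sets with empty interior. *)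

theory Defs
  imports "HOL-Analysis.Analysis"
begin

text \<open>The sumset of \<open>B\<close> and \<open>C\<close> is \<open>B + C\<close> from \<^theory>\<open>HOL-Library.Set_Algebras\<close>.
  Since \<open>card\<close> is \<open>0\<close> on infinite sets, \<open>|B| \<ge> 2\<close> is spelled out with the infinite case.\<close>

definition at_least_two :: "'a set \<Rightarrow> bool" where
  "at_least_two B \<longleftrightarrow> infinite B \<or> card B \<ge> 2"

definition irreducible_set :: "nat set \<Rightarrow> bool" where
  "irreducible_set A \<longleftrightarrow>
     \<not> (\<exists>B C :: nat set. at_least_two B \<and> at_least_two C \<and> A = B + C)"

definition totally_irreducible_set :: "nat set \<Rightarrow> bool" where
  "totally_irreducible_set A \<longleftrightarrow>
     \<not> (\<exists>B C :: nat set. at_least_two B \<and> at_least_two C \<and> finite (sym_diff A (B + C)))"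

definition comeager_in :: "'a topology \<Rightarrow> 'a set \<Rightarrow> bool" where
  "comeager_in X S \<longleftrightarrow> S \<subseteq> topspace X \<and>
     (\<exists>\<F>. countable \<F> \<and> (\<forall>F\<in>\<F>. closedin X F \<and> X interior_of F = {}) \<and>
          topspace X - S \<subseteq> \<Union>\<F>)"

definition cantor_space :: "(nat \<Rightarrow> bool) topology" where
  "cantor_space = product_topology (\<lambda>_. discrete_topology UNIV) UNIV"

text \<open>The topology on the power set of the naturals that makes the identification of a set
  with its characteristic function a homeomorphism onto the Cantor space.\<close>

definition powerset_nat_topology :: "nat set topology" where
  "powerset_nat_topology = pullback_topology UNIV (\<lambda>A n. n \<in> A) cantor_space"

lemma topspace_cantor_space: "topspace cantor_space = UNIV"
  by (simp add: cantor_space_def)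

lemma topspace_powerset_nat_topology: "topspace powerset_nat_topology = UNIV"
  by (simp add: powerset_nat_topology_def topspace_pullback_topology topspace_cantor_space)

lemma homeomorphic_map_powerset_nat_cantor:
  "homeomorphic_map powerset_nat_topology cantor_space (\<lambda>A n. n \<in> A)"
proof (rule bijective_open_imp_homeomorphic_map)
  let ?f = "\<lambda>(A::nat set) n. n \<in> A"
  have surj: "\<exists>A. ?f A = g" for g
    by (rule exI[of _ "Collect g"]) simp
  show "continuous_map powerset_nat_topology cantor_space ?f"
    unfolding continuous_map_def
    by (auto simp: powerset_nat_topology_def openin_pullback_topology
        topspace_pullback_topology topspace_cantor_space)
  show "open_map powerset_nat_topology cantor_space ?f"
    unfolding open_map_def
  proof (intro allI impI)
    fix U assume "openin powerset_nat_topology U"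
    then obtain V where V: "openin cantor_space V" "U = ?f -` V"
      by (auto simp: powerset_nat_topology_def openin_pullback_topology)
    have "?f ` (?f -` V) = V"
      using surj by (intro surj_image_vimage_eq) (metis surjI)
    then show "openin cantor_space (?f ` U)"
      using V by simp
  qed
  show "?f ` topspace powerset_nat_topology = topspace cantor_space"
    using surj by (simp add: topspace_powerset_nat_topology topspace_cantor_space) (metis surjI)
  show "inj_on ?f (topspace powerset_nat_topology)"
    by (auto simp: inj_on_def fun_eq_iff)
qed

end

theory Submission
  imports Defs
begin

text \<open>A generic set \<open>A\<close> satisfies \<open>A \<inter> {n<..3 * n + 1} = {2 * n + 1}\<close> for infinitely many \<open>n\<close>.
  Suppose that such an \<open>A\<close> agrees with \<open>B + C\<close> up to finitely many elements, let \<open>b\<^sub>0\<close>, \<open>c\<^sub>0\<close> be the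
  least elements of \<open>B\<close>, \<open>C\<close>, and write \<open>2 * n + 1 = b + c\<close>. One of \<open>b + c\<^sub>0\<close> and \<open>c + b\<^sub>0\<close> exceeds \<open>n\<close>,
  so for large \<open>n\<close> it equals \<open>2 * n + 1\<close>, the only element of \<open>A\<close> in \<open>{n<..2 * n + 1}\<close>. Replacing \<open>c\<^sub>0\<close> (or \<open>b\<^sub>0\<close>)
  by a fixed second element of \<open>C\<close> (or \<open>B\<close>) then produces an element of the gap
  \<open>{2 * n + 1<..3 * n + 1}\<close>.\<close>

text \<open>A basic open set of the product restricts only finitely many coordinates, all below some
  bound, and fixing an initial segment is itself such a restriction. Later topological arguments
  thus reduce to prescribing \<open>A \<inter> {..n}\<close>.\<close>

lemma openin_powerset_nat_iff:
  "openin powerset_nat_topology U \<longleftrightarrow>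
     (\<forall>A\<in>U. \<exists>n. \<forall>A'. A' \<inter> {..n} = A \<inter> {..n} \<longrightarrow> A' \<in> U)" (is "?L \<longleftrightarrow> ?R")
proof
  assume ?L
  then obtain V where V: "openin cantor_space V" and U: "U = (\<lambda>A n. n \<in> A) -` V"
    by (auto simp: powerset_nat_topology_def openin_pullback_topology)
  show ?R
  proof
    fix A assume "A \<in> U"
    then have "(\<lambda>n. n \<in> A) \<in> V"
      using U by simp
    then obtain W where W: "finite {i. W i \<noteq> (UNIV :: bool set)}"
        "(\<lambda>n. n \<in> A) \<in> Pi\<^sub>E UNIV W" "Pi\<^sub>E UNIV W \<subseteq> V"
      using V unfolding cantor_space_def openin_product_topology_alt by fastforce
    obtain n where n: "{i. W i \<noteq> UNIV} \<subseteq> {..n}"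
      using W(1) finite_nat_iff_bounded_le by blast
    have "A' \<in> U" if A': "A' \<inter> {..n} = A \<inter> {..n}" for A'
    proof -
      have "(i \<in> A') \<in> W i" for i
      proof (cases "i \<le> n")
        case True
        then have "i \<in> A' \<longleftrightarrow> i \<in> A"
          using A' by blast
        then show ?thesis
          using W(2) by (auto simp: PiE_iff)
      next
        case False
        then have "W i = UNIV"
          using n by auto
        then show ?thesis by simp
      qed
      then show ?thesis
        using W(3) U by (auto simp: PiE_iff)
    qed
    then show "\<exists>n. \<forall>A'. A' \<inter> {..n} = A \<inter> {..n} \<longrightarrow> A' \<in> U"
      by blast
  qed
next
  assume R: ?R
  let ?V = "{f. Collect f \<in> U}"
  have "openin cantor_space ?V"
    unfolding cantor_space_def openin_product_topology_alt
  proof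
    fix f assume "f \<in> ?V"
    then obtain n where n: "\<And>A'. A' \<inter> {..n} = Collect f \<inter> {..n} \<Longrightarrow> A' \<in> U"
      using R by blast
    define W where "W i = (if i \<le> n then {f i} else UNIV)" for i
    have "finite {i. W i \<noteq> UNIV}"
      by (rule finite_subset[of _ "{..n}"]) (auto simp: W_def)
    moreover have "f \<in> Pi\<^sub>E UNIV W"
      by (simp add: W_def PiE_iff)
    moreover have "Pi\<^sub>E UNIV W \<subseteq> ?V"
    proof
      fix g assume "g \<in> Pi\<^sub>E UNIV W"
      then have "\<forall>i. g i \<in> W i"
        by (simp add: PiE_iff)
      then have "\<forall>i\<le>n. g i = f i"
        by (metis W_def singletonD)
      then have "Collect g \<inter> {..n} = Collect f \<inter> {..n}"
        by auto
      then show "g \<in> ?V"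
        using n by blast
    qed
    ultimately show "\<exists>W. finite {i \<in> UNIV. W i \<noteq> topspace (discrete_topology UNIV)} \<and>
        (\<forall>i\<in>UNIV. openin (discrete_topology UNIV) (W i)) \<and> f \<in> Pi\<^sub>E UNIV W \<and> Pi\<^sub>E UNIV W \<subseteq> ?V"
      by auto
  qed
  moreover have "U = (\<lambda>A n. n \<in> A) -` ?V"
    by auto
  ultimately show ?L
    unfolding powerset_nat_topology_def openin_pullback_topology by auto
qed

text \<open>The window reaches \<open>n\<close> places above \<open>2 * n + 1\<close>, so it catches
  every upward shift of that element by at most \<open>n\<close>. With \<open>2 * n\<close> in the
  centre, two numbers with that sum could both equal \<open>n\<close>; with \<open>2 * n + 1\<close>
  one must exceed \<open>n\<close>.\<close>

definition isolated_pattern :: "nat set \<Rightarrow> nat \<Rightarrow> bool" where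
  "isolated_pattern A n \<longleftrightarrow> A \<inter> {n<..3 * n + 1} = {2 * n + 1}"

text \<open>Each single pattern is decided by the finite segment \<open>{..3 * n + 1}\<close>, so
  the complement is open.\<close>

lemma closedin_no_pattern:
  "closedin powerset_nat_topology {A. \<forall>n\<ge>k. \<not> isolated_pattern A n}"
proof -
  have "openin powerset_nat_topology {A. \<exists>n\<ge>k. isolated_pattern A n}"
    unfolding openin_powerset_nat_iff
  proof
    fix A assume "A \<in> {A. \<exists>n\<ge>k. isolated_pattern A n}"
    then obtain n where n: "n \<ge> k" "isolated_pattern A n"
      by blast
    have "isolated_pattern A' n" if "A' \<inter> {..3 * n + 1} = A \<inter> {..3 * n + 1}" for A'
    proof -
      have "A' \<inter> {n<..3 * n + 1} = A \<inter> {n<..3 * n + 1}"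
        using that by (auto simp: set_eq_iff)
      then show ?thesis
        using n(2) by (simp add: isolated_pattern_def)
    qed
    then show "\<exists>m. \<forall>A'. A' \<inter> {..m} = A \<inter> {..m} \<longrightarrow> A' \<in> {A. \<exists>n\<ge>k. isolated_pattern A n}"
      using n(1) by blast
  qed
  moreover have "- {A. \<forall>n\<ge>k. \<not> isolated_pattern A n} = {A. \<exists>n\<ge>k. isolated_pattern A n}"
    by auto
  ultimately show ?thesis
    by (simp add: closedin_def topspace_powerset_nat_topology Compl_eq_Diff_UNIV[symmetric])
qed

lemma interior_of_no_pattern:
  "powerset_nat_topology interior_of {A. \<forall>n\<ge>k. \<not> isolated_pattern A n} = {}"
  unfolding interior_of_eq_empty
proof (intro allI impI, elim conjE, rule ccontr)
  fix U
  assume U: "openin powerset_nat_topology U" "U \<subseteq> {A. \<forall>n\<ge>k. \<not> isolated_pattern A n}"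
    and "U \<noteq> {}"
  then obtain A where "A \<in> U"
    by blast
  then obtain m where m: "\<And>A'. A' \<inter> {..m} = A \<inter> {..m} \<Longrightarrow> A' \<in> U"
    using U(1) unfolding openin_powerset_nat_iff by blast
  \<comment> \<open>With \<open>n \<ge> m\<close>, the prescribed segment of \<open>A\<close> lies
    wholly below the window, so truncating there and adding \<open>2 * n + 1\<close> creates the
    pattern.\<close>
  define n where "n = max m k"
  define A' where "A' = insert (2 * n + 1) (A \<inter> {..m})"
  have "A' \<in> U"
    by (rule m) (auto simp: A'_def n_def)
  moreover have "isolated_pattern A' n"
    by (auto simp: isolated_pattern_def A'_def n_def)
  moreover have "n \<ge> k"
    by (simp add: n_def)
  ultimately show False
    using U(2) by blast
qed

lemma at_least_two_nat_obtains:
  fixes B :: "nat set"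
  assumes "at_least_two B"
  obtains b0 b1 where "b0 \<in> B" "b1 \<in> B" "b0 < b1" "\<And>b. b \<in> B \<Longrightarrow> b0 \<le> b"
proof -
  have "\<not> is_singleton B" "B \<noteq> {}"
    using assms by (auto simp: at_least_two_def is_singleton_altdef)
  then have "Inf B \<in> B" "B \<noteq> {Inf B}"
    by (auto simp: Inf_nat_def1 is_singleton_def)
  moreover from this obtain b1 where "b1 \<in> B" "b1 \<noteq> Inf B"
    by blast
  moreover have "Inf B \<le> b" if "b \<in> B" for b
    using that by (simp add: cInf_lower)
  ultimately show ?thesis
    using that[of "Inf B" b1] by (simp add: order.not_eq_order_implies_strict)
qed

text \<open>The roles of the summands are asymmetric here; the main argument uses this once as
  stated and once with \<open>B\<close> and \<open>C\<close> exchanged.\<close>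

lemma no_sumset_shift_into_gap:
  fixes A B C :: "nat set"
  assumes agree: "\<And>x. x > n \<Longrightarrow> x \<in> A \<longleftrightarrow> x \<in> B + C"
    and pattern: "isolated_pattern A n"
    and B: "b \<in> B" and C: "c0 \<in> C" "c1 \<in> C" "c0 < c1" "c1 \<le> n"
    and range: "n < b + c0" "b + c0 \<le> 2 * n + 1"
  shows False
proof -
  have "b + c0 \<in> A \<inter> {n<..3 * n + 1}"
    using agree B C(1) range by auto
  then have eq: "b + c0 = 2 * n + 1"
    using pattern unfolding isolated_pattern_def by blast
  \<comment> \<open>The shift \<open>c1 - c0\<close> is at most \<open>n\<close>, so the new sum
    does not leave the window.\<close>
  then have "b + c1 \<in> A \<inter> {n<..3 * n + 1}"
    using agree B C by auto
  then have "b + c1 = 2 * n + 1"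
    using pattern unfolding isolated_pattern_def by blast
  then show False
    using eq C(3) by simp
qed

lemma totally_irreducible_setI:
  assumes patterns: "\<And>k. \<exists>n\<ge>k. isolated_pattern A n"
  shows "totally_irreducible_set A"
  unfolding totally_irreducible_set_def
proof (intro notI, elim exE conjE)
  fix B C :: "nat set"
  assume "at_least_two B" "at_least_two C" and fin: "finite (sym_diff A (B + C))"
  obtain b0 b1 where b: "b0 \<in> B" "b1 \<in> B" "b0 < b1" "\<And>b. b \<in> B \<Longrightarrow> b0 \<le> b"
    using at_least_two_nat_obtains[OF \<open>at_least_two B\<close>] by metis
  obtain c0 c1 where c: "c0 \<in> C" "c1 \<in> C" "c0 < c1" "\<And>c. c \<in> C \<Longrightarrow> c0 \<le> c"
    using at_least_two_nat_obtains[OF \<open>at_least_two C\<close>] by metis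
  obtain k where k: "sym_diff A (B + C) \<subseteq> {..k}"
    using fin finite_nat_iff_bounded_le by blast
  \<comment> \<open>The bound puts all disagreements between \<open>A\<close> and
    \<open>B + C\<close> outside the window and makes both shifts at most \<open>n\<close>.\<close>
  obtain n where n: "n \<ge> k + b1 + c1" "isolated_pattern A n"
    using patterns by blast
  have agree: "x \<in> A \<longleftrightarrow> x \<in> B + C" if "x > n" for x
    using k n(1) that by fastforce
  have "2 * n + 1 \<in> A"
    using n(2) by (auto simp: isolated_pattern_def)
  then have "2 * n + 1 \<in> B + C"
    using agree by simp
  then obtain b' c' where s: "b' \<in> B" "c' \<in> C" "2 * n + 1 = b' + c'"
    by (auto elim: set_plus_elim)
  \<comment> \<open>The two sums add up to at least \<open>b' + c' = 2 * n + 1\<close>, so they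
    cannot both be at most \<open>n\<close>.\<close>
  consider "n < b' + c0" | "n < c' + b0"
    using s(3) by linarith
  then show False
  proof cases
    case 1
    show False
      using agree n(2) s(1) c(1-3)
    proof (rule no_sumset_shift_into_gap)
      \<comment> \<open>The upper bound comes from the minimality of \<open>c0\<close>, which gives
        \<open>c0 \<le> c'\<close>.\<close>
      show "c1 \<le> n" "n < b' + c0" "b' + c0 \<le> 2 * n + 1"
        using n(1) 1 s(3) c(4)[OF s(2)] by auto
    qed
  next
    case 2
    have "x \<in> A \<longleftrightarrow> x \<in> C + B" if "x > n" for x
      using agree[OF that] by (simp add: add.commute)
    then show False
      using n(2) s(2) b(1-3)
    proof (rule no_sumset_shift_into_gap)
      show "b1 \<le> n" "n < c' + b0" "c' + b0 \<le> 2 * n + 1"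
        using n(1) 2 s(3) b(4)[OF s(1)] by auto
    qed
  qed
qed

lemma totally_irreducible_imp_irreducible:
  "totally_irreducible_set A \<Longrightarrow> irreducible_set A"
proof (rule contrapos_pp)
  assume "\<not> irreducible_set A"
  then obtain B C :: "nat set" where "at_least_two B" "at_least_two C" "A = B + C"
    unfolding irreducible_set_def by blast
  moreover from this have "finite (sym_diff A (B + C))"
    by simp
  ultimately show "\<not> totally_irreducible_set A"
    unfolding totally_irreducible_set_def by blast
qed

lemma comeager_in_mono:
  "comeager_in X S \<Longrightarrow> S \<subseteq> T \<Longrightarrow> T \<subseteq> topspace X \<Longrightarrow> comeager_in X T"
  unfolding comeager_in_def using Diff_mono[OF order_refl] by (metis order_trans)

theorem theorem1p2:
  "comeager_in powerset_nat_topology {A :: nat set. totally_irreducible_set A} \<and>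
   comeager_in powerset_nat_topology {A :: nat set. irreducible_set A}"
proof -
  let ?\<F> = "range (\<lambda>k. {A. \<forall>n\<ge>k. \<not> isolated_pattern A n})"
  \<comment> \<open>By contraposition, a set that is not totally irreducible has no pattern from
    some \<open>k\<close> on.\<close>
  have "UNIV - {A. totally_irreducible_set A} \<subseteq> \<Union>?\<F>"
    using totally_irreducible_setI by blast
  then have "comeager_in powerset_nat_topology {A. totally_irreducible_set A}"
    unfolding comeager_in_def topspace_powerset_nat_topology
    using closedin_no_pattern interior_of_no_pattern
    by (intro conjI exI[of _ ?\<F>]) auto
  moreover from this have "comeager_in powerset_nat_topology {A. irreducible_set A}"
    by (rule comeager_in_mono)
      (auto simp: totally_irreducible_imp_irreducible topspace_powerset_nat_topology)
  ultimately show ?thesis ..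
qed

end
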